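(* Let $\varPhi\subset\mathbb{E}^3$ be a skew ruled surface, centrally normalized by the support function $q=\dfrac{g\,v}{w}$ with $g=g(u)$ nowhere zero. The Tchebychev vector field $\overline{T}$ of $(\varPhi,\overline{y})$ is tangential to one family of the Euclidean lines of curvature of $\varPhi$ if and only if $\varPhi$ is a relatively minimal Edlinger surface, i.e. $\kappa\lambda+1=0$, $\delta=\mathrm{const.}$ and the relative mean curvature $H$ vanishes identically. Moreover, in this case the family of Euclidean lines of curvature in question consists of the lines of curvature which are orthogonal to the striction curve.
   Context: Ruled surface: $\varPhi$ is a $C^r$ ruled surface ($r\ge3$) of nowhere vanishing Gaussian curvature in $\mathbb{E}^3$, parametrized by $\overline{x}(u,v)=\overline{s}(u)+v\,\overline{e}(u)$, $u\in I$ ($I$ an open interval), $v\in\mathbb{R}$, with $|\overline{e}|=|\overline{e}'|=1$, $\langle\overline{s}',\overline{e}'\rangle=0$ (prime $=d/du$; $\overline{s}$ parametrizes the striction curve $v=0$). Put $\overline{n}=\overline{e}'$, $\overline{z}=\overline{e}\times\overline{n}$, $\delta=(\overline{s}',\overline{e},\overline{e}')$ (nowhere zero), $\kappa=(\overline{e},\overline{e}',\overline{e}'')$, and let $\lambda=\lambda(u)$ be defined by $\overline{s}'=\delta\lambda\,\overline{e}+\delta\,\overline{z}$. Put $w=\sqrt{\delta^2+v^2}$; the unit normal is $\overline{\xi}=(\delta\overline{n}-v\overline{z})/w$, and $h_{ij}$ are the coefficients of the second fundamental form with respect to $\overline{\xi}$. Write $u^1=u,u^2=v$, $f_{/i}=\partial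 f/\partial u^i$. All functions are differentiable as often as required. An Edlinger surface is one with $\kappa\lambda+1=0$ and $\delta$ constant. Central normalization: the relative normalization with support function $q=\langle\overline{\xi},\overline{y}\rangle=gv/w$, namely $\overline{y}=-\frac{g'v+\delta\kappa g}{\delta}\,\overline{e}-g\,\overline{z}$, considered where $v\neq0$ (so that $q\ne0$); here $\overline{y}_{/i}$ is tangent to $\varPhi$. Relative shape operator: $\overline{y}_{/i}=-B_i^j\overline{x}_{/j}$; $H=\frac12(B_1^1+B_2^2)$. Relative metric: $G_{ij}=h_{ij}/q$, with inverse $G^{(ij)}$ and covariant derivative $\nabla^G$. Darboux tensor: $A_{ijk}=\frac1q\langle\overline{\xi},\nabla^G_k\nabla^G_j\overline{x}_{/i}\rangle$. Tchebychev vector: $\overline{T}=T^m\overline{x}_{/m}$, $T^m=\frac12A_i^{\,im}=\frac12 G^{(ij)}G^{(km)}A_{ijk}$ (on $v=0$, $\overline{T}$ is understood by continuous extension). *)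

theory Defs
  imports "HOL-Analysis.Analysis"
begin

section \<open>Calculus\<close>

abbreviation D :: "(real \<Rightarrow> 'a::real_normed_vector) \<Rightarrow> real \<Rightarrow> 'a" where
  "D f u \<equiv> vector_derivative f (at u)"

primrec C_k_on :: "nat \<Rightarrow> (real \<Rightarrow> 'a::real_normed_vector) \<Rightarrow> real set \<Rightarrow> bool" where
  "C_k_on 0 f I \<longleftrightarrow> continuous_on I f"
| "C_k_on (Suc k) f I \<longleftrightarrow> (\<forall>u\<in>I. f differentiable (at u)) \<and> C_k_on k (D f) I"

text \<open>Surface parameters are points \<open>p = (u, v)\<close> of \<open>real^2\<close>, with \<open>u = p $ 1\<close> and
  \<open>v = p $ 2\<close>; \<open>pd i f\<close> is the partial derivative \<open>f\<^sub>/\<^sub>i\<close>.\<close>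

definition pd :: "2 \<Rightarrow> (real^2 \<Rightarrow> 'a::real_normed_vector) \<Rightarrow> real^2 \<Rightarrow> 'a" where
  "pd i f p = vector_derivative (\<lambda>t. f (p + t *\<^sub>R axis i 1)) (at 0)"


section \<open>Skew ruled surfaces\<close>

definition n_vec :: "(real \<Rightarrow> real^3) \<Rightarrow> real \<Rightarrow> real^3" where
  "n_vec e u = D e u"

definition z_vec :: "(real \<Rightarrow> real^3) \<Rightarrow> real \<Rightarrow> real^3" where
  "z_vec e u = cross3 (e u) (n_vec e u)"

text \<open>The triple product \<open>(a, b, c)\<close> is \<open>a \<bullet> cross3 b c\<close>.\<close>

definition delta :: "(real \<Rightarrow> real^3) \<Rightarrow> (real \<Rightarrow> real^3) \<Rightarrow> real \<Rightarrow> real" where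
  "delta s e u = D s u \<bullet> cross3 (e u) (D e u)"

definition kappa :: "(real \<Rightarrow> real^3) \<Rightarrow> real \<Rightarrow> real" where
  "kappa e u = e u \<bullet> cross3 (D e u) (D (D e) u)"

definition lambda :: "(real \<Rightarrow> real^3) \<Rightarrow> (real \<Rightarrow> real^3) \<Rightarrow> real \<Rightarrow> real" where
  "lambda s e u =
     (THE l. D s u = (delta s e u * l) *\<^sub>R e u + delta s e u *\<^sub>R z_vec e u)"

definition surf :: "(real \<Rightarrow> real^3) \<Rightarrow> (real \<Rightarrow> real^3) \<Rightarrow> real^2 \<Rightarrow> real^3" where
  "surf s e p = s (p $ 1) + (p $ 2) *\<^sub>R e (p $ 1)"

definition w_fun :: "(real \<Rightarrow> real^3) \<Rightarrow> (real \<Rightarrow> real^3) \<Rightarrow> real^2 \<Rightarrow> real" where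
  "w_fun s e p = sqrt ((delta s e (p $ 1))\<^sup>2 + (p $ 2)\<^sup>2)"

definition unit_normal :: "(real \<Rightarrow> real^3) \<Rightarrow> (real \<Rightarrow> real^3) \<Rightarrow> real^2 \<Rightarrow> real^3" where
  "unit_normal s e p =
     (1 / w_fun s e p) *\<^sub>R
       (delta s e (p $ 1) *\<^sub>R n_vec e (p $ 1) - (p $ 2) *\<^sub>R z_vec e (p $ 1))"

definition first_ff :: "(real \<Rightarrow> real^3) \<Rightarrow> (real \<Rightarrow> real^3) \<Rightarrow> real^2 \<Rightarrow> real^2^2" where
  "first_ff s e p = (\<chi> i j. pd i (surf s e) p \<bullet> pd j (surf s e) p)"

definition second_ff :: "(real \<Rightarrow> real^3) \<Rightarrow> (real \<Rightarrow> real^3) \<Rightarrow> real^2 \<Rightarrow> real^2^2" where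
  "second_ff s e p = (\<chi> i j. pd j (pd i (surf s e)) p \<bullet> unit_normal s e p)"

definition gauss_curvature :: "(real \<Rightarrow> real^3) \<Rightarrow> (real \<Rightarrow> real^3) \<Rightarrow> real^2 \<Rightarrow> real" where
  "gauss_curvature s e p = det (second_ff s e p) / det (first_ff s e p)"

definition param_dom :: "real set \<Rightarrow> (real^2) set" where
  "param_dom I = {p. p $ 1 \<in> I}"

definition skew_ruled_surface ::
    "nat \<Rightarrow> (real \<Rightarrow> real^3) \<Rightarrow> (real \<Rightarrow> real^3) \<Rightarrow> real set \<Rightarrow> bool" where
  "skew_ruled_surface r s e I \<longleftrightarrow>
     open I \<and> is_interval I \<and> I \<noteq> {} \<and>
     C_k_on r s I \<and> C_k_on r e I \<and>
     (\<forall>u\<in>I. norm (e u) = 1 \<and> norm (D e u) = 1 \<and> D s u \<bullet> D e u = 0 \<and> delta s e u \<noteq> 0) \<and>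
     (\<forall>p\<in>param_dom I. gauss_curvature s e p \<noteq> 0)"

definition edlinger_surface :: "(real \<Rightarrow> real^3) \<Rightarrow> (real \<Rightarrow> real^3) \<Rightarrow> real set \<Rightarrow> bool" where
  "edlinger_surface s e I \<longleftrightarrow>
     (\<forall>u\<in>I. kappa e u * lambda s e u + 1 = 0) \<and> delta s e constant_on I"


section \<open>Euclidean lines of curvature\<close>

text \<open>\<open>X\<close> is a (nonzero) tangent vector at \<open>p\<close> in a principal direction with principal
  curvature \<open>k\<close>.\<close>

definition principal_vector ::
    "(real \<Rightarrow> real^3) \<Rightarrow> (real \<Rightarrow> real^3) \<Rightarrow> real^2 \<Rightarrow> real \<Rightarrow> real^3 \<Rightarrow> bool" where
  "principal_vector s e p k X \<longleftrightarrow>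
     X \<noteq> 0 \<and> (\<exists>a. X = (\<Sum>i\<in>UNIV. a $ i *\<^sub>R pd i (surf s e) p) \<and>
                  second_ff s e p *v a = k *\<^sub>R (first_ff s e p *v a))"

definition principal_curvatures ::
    "(real \<Rightarrow> real^3) \<Rightarrow> (real \<Rightarrow> real^3) \<Rightarrow> real^2 \<Rightarrow> real set" where
  "principal_curvatures s e p = {k. \<exists>X. principal_vector s e p k X}"

text \<open>A skew ruled surface has negative Gaussian curvature, hence no umbilics, so that the two
  families of lines of curvature are globally distinguished by the larger and the smaller
  principal curvature.\<close>

datatype curvature_family = Larger | Smaller

fun family_curvature ::
    "(real \<Rightarrow> real^3) \<Rightarrow> (real \<Rightarrow> real^3) \<Rightarrow> curvature_family \<Rightarrow> real^2 \<Rightarrow> real" where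
  "family_curvature s e Larger p = Max (principal_curvatures s e p)"
| "family_curvature s e Smaller p = Min (principal_curvatures s e p)"

definition family_direction ::
    "(real \<Rightarrow> real^3) \<Rightarrow> (real \<Rightarrow> real^3) \<Rightarrow> curvature_family \<Rightarrow> real^2 \<Rightarrow> real^3 \<Rightarrow> bool" where
  "family_direction s e F p X \<longleftrightarrow> principal_vector s e p (family_curvature s e F p) X"

definition tangential_to_family ::
    "(real \<Rightarrow> real^3) \<Rightarrow> (real \<Rightarrow> real^3) \<Rightarrow> real set \<Rightarrow> curvature_family \<Rightarrow>
     (real^2 \<Rightarrow> real^3) \<Rightarrow> bool" where
  "tangential_to_family s e I F V \<longleftrightarrow> (\<forall>p\<in>param_dom I. family_direction s e F p (V p))"

text \<open>A regular curve \<open>c\<close>, given in the parameter domain and defined on the open interval \<open>J\<close>,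
  is a line of curvature of the family \<open>F\<close>.\<close>

definition line_of_curvature ::
    "(real \<Rightarrow> real^3) \<Rightarrow> (real \<Rightarrow> real^3) \<Rightarrow> real set \<Rightarrow> curvature_family \<Rightarrow>
     real set \<Rightarrow> (real \<Rightarrow> real^2) \<Rightarrow> bool" where
  "line_of_curvature s e I F J c \<longleftrightarrow>
     open J \<and> is_interval J \<and>
     (\<forall>t\<in>J. c differentiable (at t) \<and> c t \<in> param_dom I \<and>
            family_direction s e F (c t) (D (\<lambda>\<tau>. surf s e (c \<tau>)) t))"


section \<open>The central normalization\<close>

definition support_fun ::
    "(real \<Rightarrow> real^3) \<Rightarrow> (real \<Rightarrow> real^3) \<Rightarrow> (real \<Rightarrow> real) \<Rightarrow> real^2 \<Rightarrow> real" where
  "support_fun s e g p = g (p $ 1) * p $ 2 / w_fun s e p"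

definition central_norm ::
    "(real \<Rightarrow> real^3) \<Rightarrow> (real \<Rightarrow> real^3) \<Rightarrow> (real \<Rightarrow> real) \<Rightarrow> real^2 \<Rightarrow> real^3" where
  "central_norm s e g p =
     (- ((D g (p $ 1) * p $ 2 + delta s e (p $ 1) * kappa e (p $ 1) * g (p $ 1))
          / delta s e (p $ 1))) *\<^sub>R e (p $ 1)
     - g (p $ 1) *\<^sub>R z_vec e (p $ 1)"

text \<open>The entry \<open>B $ i $ j\<close> is \<open>B\<^sub>i\<^sup>j\<close>.\<close>

definition rel_shape_operator ::
    "(real \<Rightarrow> real^3) \<Rightarrow> (real \<Rightarrow> real^3) \<Rightarrow> (real \<Rightarrow> real) \<Rightarrow> real^2 \<Rightarrow> real^2^2" where
  "rel_shape_operator s e g p =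
     (THE B. \<forall>i. pd i (central_norm s e g) p = - (\<Sum>j\<in>UNIV. B $ i $ j *\<^sub>R pd j (surf s e) p))"

definition rel_mean_curvature ::
    "(real \<Rightarrow> real^3) \<Rightarrow> (real \<Rightarrow> real^3) \<Rightarrow> (real \<Rightarrow> real) \<Rightarrow> real^2 \<Rightarrow> real" where
  "rel_mean_curvature s e g p =
     (rel_shape_operator s e g p $ 1 $ 1 + rel_shape_operator s e g p $ 2 $ 2) / 2"


section \<open>Relative metric, Darboux tensor and Tchebychev vector field\<close>

definition rel_metric ::
    "(real \<Rightarrow> real^3) \<Rightarrow> (real \<Rightarrow> real^3) \<Rightarrow> (real \<Rightarrow> real) \<Rightarrow> real^2 \<Rightarrow> real^2^2" where
  "rel_metric s e g p = (\<chi> i j. second_ff s e p $ i $ j / support_fun s e g p)"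

definition rel_metric_inv ::
    "(real \<Rightarrow> real^3) \<Rightarrow> (real \<Rightarrow> real^3) \<Rightarrow> (real \<Rightarrow> real) \<Rightarrow> real^2 \<Rightarrow> real^2^2" where
  "rel_metric_inv s e g p = matrix_inv (rel_metric s e g p)"

text \<open>\<open>christoffel G m i j\<close> is the Christoffel symbol \<open>\<Gamma>\<^sub>i\<^sub>j\<^sup>m\<close> of the metric \<open>G\<close>.\<close>

definition christoffel :: "(real^2 \<Rightarrow> real^2^2) \<Rightarrow> 2 \<Rightarrow> 2 \<Rightarrow> 2 \<Rightarrow> real^2 \<Rightarrow> real" where
  "christoffel G m i j p =
     (\<Sum>l\<in>UNIV. matrix_inv (G p) $ m $ l *
        (pd i (\<lambda>p. G p $ j $ l) p + pd j (\<lambda>p. G p $ i $ l) p - pd l (\<lambda>p. G p $ i $ j) p)) / 2"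

text \<open>Covariant derivatives of (vector-valued) covariant tensors with components \<open>\<omega> i\<close> and
  \<open>N i j\<close>, respectively; the direction of differentiation is the first index argument after
  the tensor, that is, \<open>cov1 G \<omega> j i\<close> is \<open>\<nabla>\<^sub>j \<omega>\<^sub>i\<close> and \<open>cov2 G N k i j\<close> is \<open>\<nabla>\<^sub>k N\<^sub>i\<^sub>j\<close>.\<close>

definition cov1 ::
    "(real^2 \<Rightarrow> real^2^2) \<Rightarrow> (2 \<Rightarrow> real^2 \<Rightarrow> 'a::real_normed_vector) \<Rightarrow> 2 \<Rightarrow> 2 \<Rightarrow> real^2 \<Rightarrow> 'a" where
  "cov1 G \<omega> j i p = pd j (\<omega> i) p - (\<Sum>m\<in>UNIV. christoffel G m i j p *\<^sub>R \<omega> m p)"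

definition cov2 ::
    "(real^2 \<Rightarrow> real^2^2) \<Rightarrow> (2 \<Rightarrow> 2 \<Rightarrow> real^2 \<Rightarrow> 'a::real_normed_vector) \<Rightarrow>
     2 \<Rightarrow> 2 \<Rightarrow> 2 \<Rightarrow> real^2 \<Rightarrow> 'a" where
  "cov2 G N k i j p =
     pd k (N i j) p - (\<Sum>m\<in>UNIV. christoffel G m k i p *\<^sub>R N m j p)
                    - (\<Sum>m\<in>UNIV. christoffel G m k j p *\<^sub>R N i m p)"

definition darboux ::
    "(real \<Rightarrow> real^3) \<Rightarrow> (real \<Rightarrow> real^3) \<Rightarrow> (real \<Rightarrow> real) \<Rightarrow> 2 \<Rightarrow> 2 \<Rightarrow> 2 \<Rightarrow> real^2 \<Rightarrow> real" where
  "darboux s e g i j k p =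
     (1 / support_fun s e g p) *
     (unit_normal s e p \<bullet>
        cov2 (rel_metric s e g)
          (\<lambda>i j. cov1 (rel_metric s e g) (\<lambda>i. pd i (surf s e)) j i) k i j p)"

definition tchebychev_coeff ::
    "(real \<Rightarrow> real^3) \<Rightarrow> (real \<Rightarrow> real^3) \<Rightarrow> (real \<Rightarrow> real) \<Rightarrow> 2 \<Rightarrow> real^2 \<Rightarrow> real" where
  "tchebychev_coeff s e g m p =
     (\<Sum>i\<in>UNIV. \<Sum>j\<in>UNIV. \<Sum>k\<in>UNIV.
        rel_metric_inv s e g p $ i $ j * rel_metric_inv s e g p $ k $ m * darboux s e g i j k p) / 2"

definition tchebychev_off ::
    "(real \<Rightarrow> real^3) \<Rightarrow> (real \<Rightarrow> real^3) \<Rightarrow> (real \<Rightarrow> real) \<Rightarrow> real^2 \<Rightarrow> real^3" where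
  "tchebychev_off s e g p = (\<Sum>m\<in>UNIV. tchebychev_coeff s e g m p *\<^sub>R pd m (surf s e) p)"

definition off_striction :: "real set \<Rightarrow> (real^2) set" where
  "off_striction I = {p \<in> param_dom I. p $ 2 \<noteq> 0}"

text \<open>The central normalization lives on \<open>v \<noteq> 0\<close>; on the striction curve \<open>v = 0\<close> the Tchebychev
  vector field is the continuous extension.\<close>

definition tchebychev ::
    "(real \<Rightarrow> real^3) \<Rightarrow> (real \<Rightarrow> real^3) \<Rightarrow> (real \<Rightarrow> real) \<Rightarrow> real set \<Rightarrow> real^2 \<Rightarrow> real^3" where
  "tchebychev s e g I p =
     (if p $ 2 \<noteq> 0 then tchebychev_off s e g p
      else Lim (at p within off_striction I) (tchebychev_off s e g))"

definition relatively_minimal ::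
    "(real \<Rightarrow> real^3) \<Rightarrow> (real \<Rightarrow> real^3) \<Rightarrow> (real \<Rightarrow> real) \<Rightarrow> real set \<Rightarrow> bool" where
  "relatively_minimal s e g I \<longleftrightarrow> (\<forall>p\<in>off_striction I. rel_mean_curvature s e g p = 0)"

text \<open>Orders of differentiability that, beyond \<open>s\<close> and \<open>e\<close> being of class \<open>C\<^sup>3\<close>, make the relative
  metric twice continuously differentiable off the striction curve, as the second covariant
  derivative in the Darboux tensor requires (\<open>h\<^sub>1\<^sub>1\<close> involves \<open>\<kappa>\<close>, \<open>\<lambda>\<close> and the derivative of \<open>\<delta>\<close>).\<close>

definition sufficiently_smooth ::
    "(real \<Rightarrow> real^3) \<Rightarrow> (real \<Rightarrow> real^3) \<Rightarrow> (real \<Rightarrow> real) \<Rightarrow> real set \<Rightarrow> bool" where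
  "sufficiently_smooth s e g I \<longleftrightarrow>
     C_k_on 3 (delta s e) I \<and> C_k_on 2 (kappa e) I \<and> C_k_on 2 (lambda s e) I \<and> C_k_on 2 g I"

end

theory Submission
  imports Defs
begin

text \<open>In the moving frame \<open>e, n, z\<close> the Tchebychev vector field of the central normalization is
  \<open>T = (g / \<delta>\<^sup>2) (\<delta> x\<^sub>/\<^sub>1 + \<tau> e)\<close> with \<open>\<tau> = \<beta> + \<mu> v\<close>, \<open>\<beta> = - w h\<^sub>1\<^sub>1\<close> and
  \<open>\<mu> = \<delta> g' / g - \<delta>' / 2\<close>. It is a principal direction iff
  \<open>\<mu> v \<tau> = \<delta>\<^sup>2 (\<lambda> \<beta> + w\<^sup>2 + \<delta>\<^sup>2 \<lambda>\<^sup>2)\<close>, which for fixed \<open>u\<close> is a polynomial identity of degree 3 in \<open>v\<close>.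
  Comparing coefficients gives \<open>\<kappa> \<lambda> = -1\<close> and \<open>\<delta>' = g' = 0\<close>, and \<open>H = g' / \<delta>\<close>. Conversely, under these
  conditions the principal directions are \<open>x\<^sub>/\<^sub>1\<close>, with curvature \<open>- \<kappa> / w\<close>, and \<open>T\<close>, with curvature
  \<open>\<delta>\<^sup>2 / (\<kappa> w\<^sup>3)\<close>; as \<open>\<kappa>\<close> has constant sign, \<open>T\<close> stays within one family. Along the striction
  curve \<open>x\<^sub>/\<^sub>1 = s'\<close> is orthogonal to \<open>T\<close>.\<close>

section \<open>Partial derivatives in coordinates\<close>

abbreviation pt :: "real \<Rightarrow> real \<Rightarrow> real^2" where
  "pt u v \<equiv> vector [u, v]"

lemma pt_eta: "pt (p $ 1) (p $ 2) = p"
  by (simp add: vec_eq_iff forall_2)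

lemma pt_add_axis:
  "pt u v + t *\<^sub>R axis 1 1 = pt (u + t) v" "pt u v + t *\<^sub>R axis 2 1 = pt u (v + t)"
  by (simp_all add: vec_eq_iff forall_2 axis_def)

lemma has_vector_derivative_shift_0:
  assumes "(F has_vector_derivative d) (at x)"
  shows "((\<lambda>t. F (x + t)) has_vector_derivative d) (at 0)"
proof -
  have "((\<lambda>t. x + t) has_vector_derivative 1) (at 0)"
    by (auto intro!: derivative_eq_intros)
  from vector_diff_chain_at[OF this, of F d] assms show ?thesis
    by (simp add: o_def)
qed

text \<open>A partial derivative sees only the coordinate line through the point, so a closed
  formula valid on an open parameter set \<open>S\<close> suffices. Below, \<open>S\<close> is
  \<open>I\<close> in the first variable, and the whole line or the complement of 0 in the
  second.\<close>

lemma pd_1I: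
  assumes "open S" "u \<in> S" "\<And>x. x \<in> S \<Longrightarrow> f (pt x v) = F x"
    and "(F has_vector_derivative d) (at u)"
  shows "pd 1 f (pt u v) = d"
proof -
  have "((\<lambda>x. f (pt x v)) has_vector_derivative d) (at u)"
    using assms by (intro has_vector_derivative_transform_within_open[OF assms(4,1,2)]) simp
  from has_vector_derivative_shift_0[OF this] show ?thesis
    unfolding pd_def pt_add_axis by (rule vector_derivative_at)
qed

lemma pd_2I:
  assumes "open S" "v \<in> S" "\<And>y. y \<in> S \<Longrightarrow> f (pt u y) = F y"
    and "(F has_vector_derivative d) (at v)"
  shows "pd 2 f (pt u v) = d"
proof -
  have "((\<lambda>y. f (pt u y)) has_vector_derivative d) (at v)"
    using assms by (intro has_vector_derivative_transform_within_open[OF assms(4,1,2)]) simp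
  from has_vector_derivative_shift_0[OF this] show ?thesis
    unfolding pd_def pt_add_axis by (rule vector_derivative_at)
qed

lemmas pd_1_realI = pd_1I[OF _ _ _ has_real_derivative_iff_has_vector_derivative[THEN iffD1]]
lemmas pd_2_realI = pd_2I[OF _ _ _ has_real_derivative_iff_has_vector_derivative[THEN iffD1]]

lemma D_has_vector_derivative:
  "f differentiable (at x) \<Longrightarrow> (f has_vector_derivative D f x) (at x)"
  by (simp add: vector_derivative_works)

lemma D_has_real_derivative:
  fixes f :: "real \<Rightarrow> real"
  shows "f differentiable (at x) \<Longrightarrow> (f has_real_derivative D f x) (at x)"
  by (simp add: has_real_derivative_iff_has_vector_derivative vector_derivative_works)

lemma has_vector_derivative_cross3:
  assumes "(f has_vector_derivative f') (at x)" "(h has_vector_derivative h') (at x)"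
  shows "((\<lambda>x. cross3 (f x) (h x)) has_vector_derivative cross3 (f x) h' + cross3 f' (h x)) (at x)"
  using bounded_bilinear.has_vector_derivative[OF _ assms]
    bilinear_cross[unfolded bilinear_conv_bounded_bilinear] by blast

lemma inner_derivative_eq_0:
  fixes f h :: "real \<Rightarrow> 'a::real_inner"
  assumes "open S" "x \<in> S" "\<And>y. y \<in> S \<Longrightarrow> f y \<bullet> h y = c"
    and "(f has_vector_derivative f') (at x)" "(h has_vector_derivative h') (at x)"
  shows "f x \<bullet> h' + f' \<bullet> h x = 0"
proof -
  have "((\<lambda>y. f y \<bullet> h y) has_vector_derivative f x \<bullet> h' + f' \<bullet> h x) (at x)"
    by (rule bounded_bilinear.has_vector_derivative[OF bounded_bilinear_inner assms(4,5)])
  moreover have "((\<lambda>y. f y \<bullet> h y) has_vector_derivative 0) (at x)"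
    by (rule has_vector_derivative_transform_within_open[OF has_vector_derivative_const assms(1,2)])
      (simp add: assms(3))
  ultimately show ?thesis
    by (rule vector_derivative_unique_at)
qed

text \<open>The residual of the expansion is orthogonal to \<open>a\<close>, \<open>b\<close> and
  \<open>cross3 a b\<close>. Lagrange's identity then makes its cross product with
  \<open>cross3 a b\<close> vanish too, and a vector both orthogonal and parallel to a unit vector
  is zero.\<close>

lemma orthonormal_cross3_expansion:
  fixes a b :: "real^3"
  assumes "norm a = 1" "norm b = 1" "a \<bullet> b = 0"
  shows "x = (x \<bullet> a) *\<^sub>R a + (x \<bullet> b) *\<^sub>R b + (x \<bullet> cross3 a b) *\<^sub>R cross3 a b"
proof -
  have sq: "a \<bullet> a = 1" "b \<bullet> b = 1" "b \<bullet> a = 0"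
    using assms by (simp_all add: dot_square_norm inner_commute)
  have c: "norm (cross3 a b) = 1"
    using norm_cross_dot[of a b] assms by (simp add: power2_eq_1_iff) (smt (verit) norm_ge_zero)
  define y where "y = x - ((x \<bullet> a) *\<^sub>R a + (x \<bullet> b) *\<^sub>R b + (x \<bullet> cross3 a b) *\<^sub>R cross3 a b)"
  have y: "y \<bullet> a = 0" "y \<bullet> b = 0" "y \<bullet> cross3 a b = 0"
    using c assms sq by (simp_all add: y_def inner_diff_left inner_add_left dot_cross_self dot_square_norm)
  have "cross3 y (cross3 a b) = (y \<bullet> b) *\<^sub>R a - (y \<bullet> a) *\<^sub>R b"
    by (rule Lagrange)
  with y have "cross3 y (cross3 a b) = 0"
    by simp
  with norm_cross_dot[of y "cross3 a b"] y c have "y = 0"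
    by simp
  then show ?thesis
    by (simp add: y_def)
qed

text \<open>\<open>matrix_inv\<close> chooses a two-sided inverse; for square matrices a right
  inverse is two-sided, and two-sided inverses are unique.\<close>

lemma matrix_inv_right_eq:
  fixes A :: "real^'n^'n"
  assumes "A ** B = mat 1"
  shows "matrix_inv A = B"
proof -
  have "B ** A = mat 1"
    using assms by (simp add: matrix_left_right_inverse)
  with assms have "\<exists>A'. A ** A' = mat 1 \<and> A' ** A = mat 1"
    by blast
  then have "matrix_inv A ** A = mat 1"
    unfolding matrix_inv_def by (rule someI2_ex) simp
  then have "matrix_inv A ** (A ** B) = B"
    by (simp add: matrix_mul_assoc)
  with assms show ?thesis
    by simp
qed

section \<open>The moving frame\<close>

locale central_surface =
  fixes s e :: "real \<Rightarrow> real^3" and g :: "real \<Rightarrow> real" and I :: "real set" and r :: nat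
  assumes r: "r \<ge> 3"
    and skew: "skew_ruled_surface r s e I"
    and smooth: "sufficiently_smooth s e g I"
    and g_nz: "\<And>u. u \<in> I \<Longrightarrow> g u \<noteq> 0"
begin

abbreviation N where "N \<equiv> n_vec e"
abbreviation Z where "Z \<equiv> z_vec e"
abbreviation d where "d \<equiv> delta s e"
abbreviation k where "k \<equiv> kappa e"
abbreviation l where "l \<equiv> lambda s e"

lemma open_I: "open I" and interval_I: "is_interval I" and I_ne: "I \<noteq> {}"
  using skew by (auto simp: skew_ruled_surface_def)

lemma in_dom: "pt u v \<in> param_dom I \<longleftrightarrow> u \<in> I"
  by (simp add: param_dom_def)

lemma in_off: "pt u v \<in> off_striction I \<longleftrightarrow> u \<in> I \<and> v \<noteq> 0"
  by (simp add: param_dom_def off_striction_def)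

context
  fixes u
  assumes u: "u \<in> I"
begin

lemma diffs:
  "s differentiable (at u)" "D s differentiable (at u)"
  "e differentiable (at u)" "D e differentiable (at u)"
  "d differentiable (at u)" "D d differentiable (at u)" "k differentiable (at u)"
  "l differentiable (at u)" "g differentiable (at u)" "D g differentiable (at u)"
proof -
  obtain r' where r': "r = Suc (Suc (Suc r'))"
    using r by (metis add_2_eq_Suc add_Suc_right le_Suc_ex numeral_3_eq_3 plus_nat.simps numeral_2_eq_2)
  show "s differentiable (at u)" "D s differentiable (at u)"
    "e differentiable (at u)" "D e differentiable (at u)"
    using skew u by (auto simp: skew_ruled_surface_def r')
  show "d differentiable (at u)" "D d differentiable (at u)" "k differentiable (at u)"
    "l differentiable (at u)" "g differentiable (at u)" "D g differentiable (at u)"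
    using smooth u by (auto simp: sufficiently_smooth_def numeral_3_eq_3 numeral_2_eq_2)
qed

lemma d_nz: "d u \<noteq> 0"
  using skew u by (auto simp: skew_ruled_surface_def)

lemma norm_E: "norm (e u) = 1" and norm_N: "norm (N u) = 1" and Ds_N: "D s u \<bullet> N u = 0"
  using skew u by (auto simp: skew_ruled_surface_def n_vec_def)

lemma E_has_derivative: "(e has_vector_derivative N u) (at u)"
  unfolding n_vec_def by (intro D_has_vector_derivative diffs)

end

text \<open>Differentiate \<open>e u \<bullet> e u = 1\<close>.\<close>

lemma E_N: "u \<in> I \<Longrightarrow> e u \<bullet> N u = 0"
  using inner_derivative_eq_0[OF open_I, of u e e 1, OF _ _ E_has_derivative E_has_derivative]
  by (simp add: dot_square_norm norm_E inner_commute)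

context
  fixes u
  assumes u: "u \<in> I"
begin

lemma frame:
  "e u \<bullet> e u = 1" "N u \<bullet> N u = 1" "Z u \<bullet> Z u = 1"
  "e u \<bullet> N u = 0" "N u \<bullet> e u = 0" "e u \<bullet> Z u = 0" "Z u \<bullet> e u = 0" "N u \<bullet> Z u = 0" "Z u \<bullet> N u = 0"
proof -
  show *: "e u \<bullet> e u = 1" "N u \<bullet> N u = 1" "e u \<bullet> N u = 0" "N u \<bullet> e u = 0"
    using u by (simp_all add: dot_square_norm norm_E norm_N E_N inner_commute)
  show "Z u \<bullet> Z u = 1"
    using norm_cross_dot[of "e u" "N u"] * u
    by (simp add: z_vec_def dot_square_norm norm_E norm_N)
  show "e u \<bullet> Z u = 0" "Z u \<bullet> e u = 0" "N u \<bullet> Z u = 0" "Z u \<bullet> N u = 0"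
    by (simp_all add: z_vec_def dot_cross_self)
qed

lemma frame_expansion:
  "x = (x \<bullet> e u) *\<^sub>R e u + (x \<bullet> N u) *\<^sub>R N u + (x \<bullet> Z u) *\<^sub>R Z u"
  unfolding z_vec_def using u by (intro orthonormal_cross3_expansion norm_E norm_N E_N)

lemma frame_eqI:
  "x \<bullet> e u = y \<bullet> e u \<Longrightarrow> x \<bullet> N u = y \<bullet> N u \<Longrightarrow> x \<bullet> Z u = y \<bullet> Z u \<Longrightarrow> x = y"
  using frame_expansion[of x] frame_expansion[of y] by simp

text \<open>A Frenet-type equation of the frame. The \<open>e\<close> and \<open>N\<close>
  components come from differentiating \<open>e \<bullet> N = 0\<close> and
  \<open>N \<bullet> N = 1\<close>; the \<open>Z\<close> component is the triple product
  \<open>kappa\<close> up to cyclic permutation.\<close>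

lemma N_has_derivative: "(N has_vector_derivative (- e u + k u *\<^sub>R Z u)) (at u)"
proof -
  have N': "(N has_vector_derivative D N u) (at u)"
    using diffs(4)[OF u] unfolding n_vec_def by (rule D_has_vector_derivative)
  have a: "D N u \<bullet> e u = -1"
    using inner_derivative_eq_0[OF open_I u, of e N 0, OF _ E_has_derivative[OF u] N']
    by (simp add: E_N frame inner_commute)
  have b: "D N u \<bullet> N u = 0"
    using inner_derivative_eq_0[OF open_I u, of N N 1, OF _ N' N']
    by (simp add: dot_square_norm norm_N inner_commute)
  have "N = D e"
    by (simp add: n_vec_def fun_eq_iff)
  then have c: "D N u \<bullet> Z u = k u"
    unfolding kappa_def z_vec_def by (metis cross_triple inner_commute)
  show ?thesis
    using N' frame_expansion[of "D N u"] by (simp add: a b c)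
qed

lemma Z_has_derivative: "(Z has_vector_derivative (- k u *\<^sub>R N u)) (at u)"
proof -
  have "cross3 (e u) (Z u) = - N u"
    unfolding z_vec_def by (simp add: Lagrange frame)
  then have "cross3 (e u) (- e u + k u *\<^sub>R Z u) + cross3 (N u) (N u) = - k u *\<^sub>R N u"
    by (simp only: cross_add_right cross_mult_right cross_minus_right cross_refl) simp
  with has_vector_derivative_cross3[OF E_has_derivative[OF u] N_has_derivative] show ?thesis
    unfolding z_vec_def[abs_def] by simp
qed

text \<open>\<open>lambda\<close> is a definite description, so existence and uniqueness are both
  due. The vanishing \<open>N\<close> component of \<open>D s u\<close> gives the first,
  \<open>d u\<close> being nonzero the second.\<close>

lemma Ds: "D s u = (d u * l u) *\<^sub>R e u + d u *\<^sub>R Z u"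
proof -
  define c where "c = (D s u \<bullet> e u) / d u"
  have "D s u \<bullet> Z u = d u"
    by (simp add: delta_def z_vec_def n_vec_def)
  then have c: "D s u = (d u * c) *\<^sub>R e u + d u *\<^sub>R Z u"
    using frame_expansion[of "D s u"] Ds_N[OF u] d_nz[OF u] by (simp add: c_def)
  have "l u = c"
    unfolding lambda_def
  proof (rule the_equality)
    show "D s u = (d u * c) *\<^sub>R e u + d u *\<^sub>R Z u" by (rule c)
    fix x assume "D s u = (d u * x) *\<^sub>R e u + d u *\<^sub>R Z u"
    with c have "(d u * x) *\<^sub>R e u = (d u * c) *\<^sub>R e u" by simp
    then show "x = c"
      using d_nz[OF u] norm_E[OF u] by auto
  qed
  with c show ?thesis by simp
qed

lemma s_has_derivative: "(s has_vector_derivative (d u * l u) *\<^sub>R e u + d u *\<^sub>R Z u) (at u)"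
  using D_has_vector_derivative[OF diffs(1)[OF u]] by (simp add: Ds)

lemmas scalar_derivatives =
  D_has_real_derivative[OF diffs(5)[OF u]] D_has_real_derivative[OF diffs(6)[OF u]]
  D_has_real_derivative[OF diffs(7)[OF u]] D_has_real_derivative[OF diffs(8)[OF u]]
  D_has_real_derivative[OF diffs(9)[OF u]] D_has_real_derivative[OF diffs(10)[OF u]]

end

lemmas surface_derivatives =
  s_has_derivative E_has_derivative N_has_derivative Z_has_derivative scalar_derivatives

section \<open>Fundamental forms\<close>

text \<open>The coordinate tangent vector \<open>x_/1 = s' + v e'\<close>, resolved in the moving
  frame.\<close>

definition X1 :: "real \<Rightarrow> real \<Rightarrow> real^3" where
  "X1 u v = (d u * l u) *\<^sub>R e u + v *\<^sub>R N u + d u *\<^sub>R Z u"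

definition beta :: "real \<Rightarrow> real \<Rightarrow> real" where
  "beta u v = k u * v\<^sup>2 + D d u * v + (d u)\<^sup>2 * (k u - l u)"

lemma surf_pt: "surf s e (pt u v) = s u + v *\<^sub>R e u"
  by (simp add: surf_def)

lemma pd_2_surf: "pd 2 (surf s e) (pt u v) = e u"
  by (rule pd_2I[OF open_UNIV UNIV_I, where F = "\<lambda>v. s u + v *\<^sub>R e u"])
    (auto simp: surf_pt intro!: derivative_eq_intros)

lemma pd_22_surf: "pd 2 (pd 2 (surf s e)) (pt u v) = 0"
  by (rule pd_2I[OF open_UNIV UNIV_I, where F = "\<lambda>v. e u"]) (auto simp: pd_2_surf)

context
  fixes u
  assumes u: "u \<in> I"
begin

lemma pd_1_surf: "pd 1 (surf s e) (pt u v) = X1 u v"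
  by (rule pd_1I[OF open_I u, where F = "\<lambda>u. s u + v *\<^sub>R e u"])
    (auto intro!: derivative_eq_intros surface_derivatives u simp: surf_pt X1_def)

lemma pd_12_surf: "pd 1 (pd 2 (surf s e)) (pt u v) = N u"
  by (rule pd_1I[OF open_I u, where F = e]) (auto simp: pd_2_surf intro: surface_derivatives u)

end

lemma pd_21_surf: "u \<in> I \<Longrightarrow> pd 2 (pd 1 (surf s e)) (pt u v) = N u"
  by (rule pd_2I[OF open_UNIV UNIV_I, where F = "X1 u"])
    (auto intro!: derivative_eq_intros simp: pd_1_surf X1_def[abs_def])

lemma pd_11_surf:
  assumes u: "u \<in> I"
  shows "pd 1 (pd 1 (surf s e)) (pt u v) =
    (D d u * l u + d u * D l u - v) *\<^sub>R e u + (d u * (l u - k u)) *\<^sub>R N u + (v * k u + D d u) *\<^sub>R Z u"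
  by (rule pd_1I[OF open_I u, where F = "\<lambda>u. X1 u v"])
    (auto intro!: derivative_eq_intros surface_derivatives u simp: pd_1_surf X1_def algebra_simps)

definition w :: "real \<Rightarrow> real \<Rightarrow> real" where
  "w u v = sqrt ((d u)\<^sup>2 + v\<^sup>2)"

lemma w_fun_pt: "w_fun s e (pt u v) = w u v"
  by (simp add: w_fun_def w_def)

lemma w_pos: "u \<in> I \<Longrightarrow> w u v > 0"
  using d_nz[of u] by (simp add: w_def sum_power2_gt_zero_iff)

lemma w_sq: "(w u v)\<^sup>2 = (d u)\<^sup>2 + v\<^sup>2"
  by (simp add: w_def)

lemma unit_normal_pt: "unit_normal s e (pt u v) = (1 / w u v) *\<^sub>R (d u *\<^sub>R N u - v *\<^sub>R Z u)"
  by (simp add: unit_normal_def w_fun_pt)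

lemma second_ff_pt:
  assumes u: "u \<in> I"
  shows "second_ff s e (pt u v) $ 1 $ 1 = - beta u v / w u v"
    "second_ff s e (pt u v) $ 1 $ 2 = d u / w u v"
    "second_ff s e (pt u v) $ 2 $ 1 = d u / w u v"
    "second_ff s e (pt u v) $ 2 $ 2 = 0"
  using w_pos[OF u, of v] by (simp_all add: second_ff_def pd_11_surf pd_12_surf pd_21_surf pd_22_surf u unit_normal_pt
    frame inner_simps beta_def field_simps power2_eq_square)

lemma first_ff_pt:
  assumes u: "u \<in> I"
  shows "first_ff s e (pt u v) $ 1 $ 1 = (w u v)\<^sup>2 + (d u)\<^sup>2 * (l u)\<^sup>2"
    "first_ff s e (pt u v) $ 1 $ 2 = d u * l u"
    "first_ff s e (pt u v) $ 2 $ 1 = d u * l u"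
    "first_ff s e (pt u v) $ 2 $ 2 = 1"
  by (simp_all add: first_ff_def pd_1_surf pd_2_surf u X1_def frame inner_simps w_sq[unfolded power2_eq_square] power2_eq_square)

text \<open>Of the two vectors only \<open>X1\<close> has a \<open>Z\<close> component, namely
  \<open>d u\<close>, which is nonzero. Coefficients of tangent vectors can therefore be
  compared.\<close>

lemma X1_E_independent:
  assumes u: "u \<in> I" and "a *\<^sub>R X1 u v + b *\<^sub>R e u = a' *\<^sub>R X1 u v + b' *\<^sub>R e u"
  shows "a = a'" "b = b'"
proof -
  have "(a *\<^sub>R X1 u v + b *\<^sub>R e u) \<bullet> Z u = (a' *\<^sub>R X1 u v + b' *\<^sub>R e u) \<bullet> Z u"
    using assms by simp
  then show "a = a'"
    using d_nz[OF u] by (simp add: X1_def inner_simps frame u)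
  with assms(2) norm_E[OF u] show "b = b'" by auto
qed

section \<open>Relative shape operator\<close>

text \<open>In \<open>y_/1\<close> the terms with \<open>k\<close> cancel along \<open>N\<close>,
  leaving a multiple of \<open>X1\<close> plus a multiple of \<open>e\<close>; \<open>y_/2\<close>
  is the same multiple of \<open>e\<close>. The shape operator is thus triangular with both diagonal
  entries \<open>D g u / d u\<close>, whatever \<open>v\<close> is.\<close>

lemma rel_mean_curvature_pt:
  assumes u: "u \<in> I"
  shows "rel_mean_curvature s e g (pt u v) = D g u / d u"
proof -
  \<comment> \<open>Minus the \<open>e\<close> component of the central normalization, as a function
    of \<open>u\<close> for fixed \<open>v\<close>.\<close>
  define h where "h = (\<lambda>u. (D g u * v + d u * k u * g u) / d u)"
  define h' where "h' = ((D (D g) u * v + D d u * k u * g u + d u * D k u * g u + d u * k u * D g u) * d u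
    - (D g u * v + d u * k u * g u) * D d u) / (d u)\<^sup>2"
  have h: "(h has_real_derivative h') (at u)"
    unfolding h_def h'_def using d_nz[OF u]
    by (auto intro!: derivative_eq_intros scalar_derivatives u simp: algebra_simps power2_eq_square)
  have 1: "pd 1 (central_norm s e g) (pt u v) =
      - ((D g u / d u) *\<^sub>R X1 u v + (h' - D g u * l u) *\<^sub>R e u)"
  proof (rule pd_1I[OF open_I u, where F = "\<lambda>u. - h u *\<^sub>R e u - g u *\<^sub>R Z u"])
    have "((\<lambda>u. - h u *\<^sub>R e u - g u *\<^sub>R Z u) has_vector_derivative
        (- h u *\<^sub>R N u - h' *\<^sub>R e u) - (g u *\<^sub>R (- k u *\<^sub>R N u) + D g u *\<^sub>R Z u)) (at u)"
      by (auto intro!: derivative_eq_intros surface_derivatives h u)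
    also have "(- h u *\<^sub>R N u - h' *\<^sub>R e u) - (g u *\<^sub>R (- k u *\<^sub>R N u) + D g u *\<^sub>R Z u) =
        - ((D g u / d u) *\<^sub>R X1 u v + (h' - D g u * l u) *\<^sub>R e u)"
      using d_nz[OF u] by (intro frame_eqI[OF u])
        (simp_all add: X1_def inner_simps frame u h_def field_simps)
    finally show "((\<lambda>u. - h u *\<^sub>R e u - g u *\<^sub>R Z u) has_vector_derivative
        - ((D g u / d u) *\<^sub>R X1 u v + (h' - D g u * l u) *\<^sub>R e u)) (at u)" .
  qed (simp add: central_norm_def h_def)
  have 2: "pd 2 (central_norm s e g) (pt u v) = - ((D g u / d u) *\<^sub>R e u)"
    by (rule pd_2I[OF open_UNIV UNIV_I,
          where F = "\<lambda>v. - ((D g u * v + d u * k u * g u) / d u) *\<^sub>R e u - g u *\<^sub>R Z u"])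
      (auto intro!: derivative_eq_intros simp: central_norm_def d_nz u)
  define B :: "real^2^2" where "B = vector [vector [D g u / d u, h' - D g u * l u], vector [0, D g u / d u]]"
  have "rel_shape_operator s e g (pt u v) = B"
    unfolding rel_shape_operator_def
  proof (rule the_equality)
    show "\<forall>i. pd i (central_norm s e g) (pt u v) = - (\<Sum>j\<in>UNIV. B $ i $ j *\<^sub>R pd j (surf s e) (pt u v))"
      by (simp add: forall_2 sum_2 1 2 pd_1_surf pd_2_surf u B_def)
  next
    fix B'
    assume "\<forall>i. pd i (central_norm s e g) (pt u v) = - (\<Sum>j\<in>UNIV. B' $ i $ j *\<^sub>R pd j (surf s e) (pt u v))"
    then have "(D g u / d u) *\<^sub>R X1 u v + (h' - D g u * l u) *\<^sub>R e u = B' $ 1 $ 1 *\<^sub>R X1 u v + B' $ 1 $ 2 *\<^sub>R e u"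
      "0 *\<^sub>R X1 u v + (D g u / d u) *\<^sub>R e u = B' $ 2 $ 1 *\<^sub>R X1 u v + B' $ 2 $ 2 *\<^sub>R e u"
      unfolding forall_2 sum_2 1 2 pd_1_surf[OF u] pd_2_surf neg_equal_iff_equal by simp_all
    from X1_E_independent[OF u this(1)] X1_E_independent[OF u this(2)] show "B' = B"
      by (simp add: vec_eq_iff forall_2 B_def)
  qed
  then show ?thesis
    by (simp add: rel_mean_curvature_def B_def)
qed

section \<open>The Tchebychev vector field\<close>

abbreviation G where "G \<equiv> rel_metric s e g"

lemma support_fun_pt: "support_fun s e g (pt u v) = g u * v / w u v"
  by (simp add: support_fun_def w_fun_pt)

context
  fixes u
  assumes u: "u \<in> I"
begin

text \<open>The factor \<open>w\<close> cancels between second fundamental form and support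
  function. At \<open>v = 0\<close> division by zero makes both sides 0, so the formulas hold on the
  whole line when differentiated in \<open>v\<close>.\<close>

lemma rel_metric_pt:
  "G (pt u v) $ 1 $ 1 = - beta u v / (g u * v)"
  "G (pt u v) $ 1 $ 2 = d u / (g u * v)"
  "G (pt u v) $ 2 $ 1 = d u / (g u * v)"
  "G (pt u v) $ 2 $ 2 = 0"
  using w_pos[OF u, of v] by (simp_all add: rel_metric_def second_ff_pt support_fun_pt u)

text \<open>The rulings are asymptotic lines, so \<open>G_22 = 0\<close> and hence
  \<open>G^11 = 0\<close>, a zero that shortens all later contractions.\<close>

lemma rel_metric_inv_pt:
  assumes "v \<noteq> 0"
  shows "matrix_inv (G (pt u v)) $ 1 $ 1 = 0"
    "matrix_inv (G (pt u v)) $ 1 $ 2 = g u * v / d u"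
    "matrix_inv (G (pt u v)) $ 2 $ 1 = g u * v / d u"
    "matrix_inv (G (pt u v)) $ 2 $ 2 = beta u v * g u * v / (d u)\<^sup>2"
proof -
  have "matrix_inv (G (pt u v)) =
      vector [vector [0, g u * v / d u], vector [g u * v / d u, beta u v * g u * v / (d u)\<^sup>2]]"
    using assms d_nz[OF u] g_nz[OF u]
    by (intro matrix_inv_right_eq)
      (simp add: vec_eq_iff forall_2 matrix_matrix_mult_def sum_2 mat_def rel_metric_pt
        field_simps power2_eq_square)
  then show "matrix_inv (G (pt u v)) $ 1 $ 1 = 0"
    "matrix_inv (G (pt u v)) $ 1 $ 2 = g u * v / d u"
    "matrix_inv (G (pt u v)) $ 2 $ 1 = g u * v / d u"
    "matrix_inv (G (pt u v)) $ 2 $ 2 = beta u v * g u * v / (d u)\<^sup>2"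
    by simp_all
qed

end

lemma pd_rel_metric:
  assumes u: "u \<in> I" and v: "v \<noteq> 0"
  shows "pd 1 (\<lambda>p. G p $ 1 $ 2) (pt u v) = (D d u * g u - d u * D g u) / ((g u)\<^sup>2 * v)"
    "pd 1 (\<lambda>p. G p $ 2 $ 1) (pt u v) = (D d u * g u - d u * D g u) / ((g u)\<^sup>2 * v)"
    "pd 1 (\<lambda>p. G p $ 2 $ 2) (pt u v) = 0"
    "pd 2 (\<lambda>p. G p $ 1 $ 1) (pt u v) = - (k u - (d u)\<^sup>2 * (k u - l u) / v\<^sup>2) / g u"
    "pd 2 (\<lambda>p. G p $ 1 $ 2) (pt u v) = - d u / (g u * v\<^sup>2)"
    "pd 2 (\<lambda>p. G p $ 2 $ 1) (pt u v) = - d u / (g u * v\<^sup>2)"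
    "pd 2 (\<lambda>p. G p $ 2 $ 2) (pt u v) = 0"
proof -
  have *: "((\<lambda>u. d u / (g u * v)) has_real_derivative (D d u * g u - d u * D g u) / ((g u)\<^sup>2 * v)) (at u)"
    using v g_nz[OF u]
    by (auto intro!: derivative_eq_intros scalar_derivatives u simp: field_simps power2_eq_square)
  show "pd 1 (\<lambda>p. G p $ 1 $ 2) (pt u v) = (D d u * g u - d u * D g u) / ((g u)\<^sup>2 * v)"
    "pd 1 (\<lambda>p. G p $ 2 $ 1) (pt u v) = (D d u * g u - d u * D g u) / ((g u)\<^sup>2 * v)"
    by (rule pd_1_realI[OF open_I u _ *]; simp add: rel_metric_pt)+
  show "pd 1 (\<lambda>p. G p $ 2 $ 2) (pt u v) = 0"
    by (rule pd_1I[OF open_I u, where F = "\<lambda>u. 0"]) (simp_all add: rel_metric_pt)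
  show "pd 2 (\<lambda>p. G p $ 2 $ 2) (pt u v) = 0"
    by (rule pd_2I[OF open_UNIV UNIV_I, where F = "\<lambda>v. 0"]) (simp_all add: rel_metric_pt u)
  have *: "((\<lambda>v. d u / (g u * v)) has_real_derivative - d u / (g u * v\<^sup>2)) (at v)"
    using v g_nz[OF u]
    by (auto intro!: derivative_eq_intros simp: field_simps power2_eq_square)
  show "pd 2 (\<lambda>p. G p $ 1 $ 2) (pt u v) = - d u / (g u * v\<^sup>2)"
    "pd 2 (\<lambda>p. G p $ 2 $ 1) (pt u v) = - d u / (g u * v\<^sup>2)"
    by (rule pd_2_realI[OF open_UNIV UNIV_I _ *]; simp add: rel_metric_pt u)+
  have "((\<lambda>v. - beta u v / (g u * v)) has_real_derivative
      - (k u - (d u)\<^sup>2 * (k u - l u) / v\<^sup>2) / g u) (at v)"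
    using v g_nz[OF u] unfolding beta_def
    by (auto intro!: derivative_eq_intros simp: field_simps power2_eq_square)
  then show "pd 2 (\<lambda>p. G p $ 1 $ 1) (pt u v) = - (k u - (d u)\<^sup>2 * (k u - l u) / v\<^sup>2) / g u"
    by (intro pd_2_realI[OF open_UNIV UNIV_I]) (simp_all add: rel_metric_pt u)
qed

text \<open>\<open>Gamma\<close> is the Christoffel symbol \<open>\<Gamma>\<^sub>1\<^sub>2\<^sup>2\<close> of the relative metric.\<close>

definition Gamma :: "real \<Rightarrow> real \<Rightarrow> real" where
  "Gamma u v = - (v / (2 * d u)) * (k u - (d u)\<^sup>2 * (k u - l u) / v\<^sup>2)"

text \<open>The symbol with upper index 2 and lower indices 1, 1 is absent from the list: in the
  Darboux components computed below it is multiplied by the entry 2, 2 of \<open>second_ff\<close>,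
  which is 0.\<close>

lemma christoffel_pt:
  assumes u: "u \<in> I" and v: "v \<noteq> 0"
  shows "christoffel G 1 1 2 (pt u v) = 0" "christoffel G 1 2 1 (pt u v) = 0"
    "christoffel G 2 1 2 (pt u v) = Gamma u v" "christoffel G 2 2 1 (pt u v) = Gamma u v"
    "christoffel G 1 2 2 (pt u v) = 0" "christoffel G 2 2 2 (pt u v) = - 1 / v"
    "christoffel G 1 1 1 (pt u v) = (D d u * g u - d u * D g u) / (d u * g u) - Gamma u v"
  using v g_nz[OF u] d_nz[OF u]
  by (simp_all add: christoffel_def sum_2 rel_metric_inv_pt pd_rel_metric u Gamma_def field_simps power2_eq_square)

section \<open>Second covariant derivatives and the Darboux tensor\<close>

abbreviation M where
  "M \<equiv> \<lambda>i j. cov1 G (\<lambda>i. pd i (surf s e)) j i"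

lemma unit_normal_tangent:
  assumes u: "u \<in> I"
  shows "unit_normal s e (pt u v) \<bullet> X1 u v = 0" "unit_normal s e (pt u v) \<bullet> e u = 0"
    "X1 u v \<bullet> unit_normal s e (pt u v) = 0" "e u \<bullet> unit_normal s e (pt u v) = 0"
  by (simp_all add: unit_normal_pt X1_def inner_simps frame u)

text \<open>The Christoffel terms subtract only tangent vectors. This turns the corrections in the
  Darboux tensor into entries of \<open>second_ff\<close>.\<close>

lemma unit_normal_M:
  assumes u: "u \<in> I"
  shows "unit_normal s e (pt u v) \<bullet> M i j (pt u v) = second_ff s e (pt u v) $ i $ j"
  by (simp add: cov1_def sum_2 second_ff_def inner_simps pd_1_surf pd_2_surf u unit_normal_tangent inner_commute)

lemma M_pt:
  assumes u: "u \<in> I" and v: "v \<noteq> 0"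
  shows "M 1 2 (pt u v) = N u - Gamma u v *\<^sub>R e u"
    "M 2 1 (pt u v) = N u - Gamma u v *\<^sub>R e u"
    "M 2 2 (pt u v) = (1 / v) *\<^sub>R e u"
  by (simp_all add: cov1_def sum_2 christoffel_pt pd_12_surf pd_21_surf pd_22_surf pd_2_surf u v)

lemma unit_normal_pd_M:
  assumes u: "u \<in> I" and v: "v \<noteq> 0"
  shows "unit_normal s e (pt u v) \<bullet> pd 1 (M 1 2) (pt u v) = - (v * k u + d u * Gamma u v) / w u v"
    "unit_normal s e (pt u v) \<bullet> pd 1 (M 2 1) (pt u v) = - (v * k u + d u * Gamma u v) / w u v"
    "unit_normal s e (pt u v) \<bullet> pd 2 (M 1 2) (pt u v) = 0"
    "unit_normal s e (pt u v) \<bullet> pd 2 (M 2 1) (pt u v) = 0"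
    "unit_normal s e (pt u v) \<bullet> pd 1 (M 2 2) (pt u v) = d u / (v * w u v)"
    "unit_normal s e (pt u v) \<bullet> pd 2 (M 2 2) (pt u v) = 0"
proof -
  \<comment> \<open>The formulas for \<open>M\<close> hold only off the striction curve, so
    derivatives in \<open>v\<close> are taken on the complement of 0.\<close>
  have op: "open (- {0::real})" "v \<in> - {0}"
    using v by auto
  \<comment> \<open>The derivative \<open>c\<close> of \<open>Gamma\<close> may stay unspecified: it
    multiplies the tangent vector \<open>e\<close> and disappears against the normal.\<close>
  have "(\<lambda>u. Gamma u v) differentiable (at u)"
    unfolding Gamma_def using v d_nz[OF u] by (intro derivative_intros diffs u) auto
  then obtain c where c: "((\<lambda>u. Gamma u v) has_real_derivative c) (at u)"
    using D_has_real_derivative by blast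
  have "((\<lambda>u. N u - Gamma u v *\<^sub>R e u) has_vector_derivative
      - e u + k u *\<^sub>R Z u - (Gamma u v *\<^sub>R N u + c *\<^sub>R e u)) (at u)"
    by (auto intro!: derivative_eq_intros surface_derivatives c u)
  from pd_1I[OF open_I u _ this, of "M 1 2"] pd_1I[OF open_I u _ this, of "M 2 1"]
  have pd_1_M: "pd 1 (M 1 2) (pt u v) = - e u + k u *\<^sub>R Z u - (Gamma u v *\<^sub>R N u + c *\<^sub>R e u)"
    "pd 1 (M 2 1) (pt u v) = - e u + k u *\<^sub>R Z u - (Gamma u v *\<^sub>R N u + c *\<^sub>R e u)"
    using v by (simp_all add: M_pt)
  show "unit_normal s e (pt u v) \<bullet> pd 1 (M 1 2) (pt u v) = - (v * k u + d u * Gamma u v) / w u v"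
    "unit_normal s e (pt u v) \<bullet> pd 1 (M 2 1) (pt u v) = - (v * k u + d u * Gamma u v) / w u v"
    using w_pos[OF u, of v] unfolding pd_1_M
    by (simp_all add: unit_normal_pt inner_simps frame u field_simps)
  have "Gamma u differentiable (at v)"
    unfolding Gamma_def[abs_def] using v d_nz[OF u] by (intro derivative_intros) auto
  then obtain c where c: "(Gamma u has_real_derivative c) (at v)"
    using D_has_real_derivative by blast
  then have "((\<lambda>v. N u - Gamma u v *\<^sub>R e u) has_vector_derivative - (c *\<^sub>R e u)) (at v)"
    by (auto intro!: derivative_eq_intros)
  from pd_2I[OF op _ this, of "M 1 2"] pd_2I[OF op _ this, of "M 2 1"]
  have "pd 2 (M 1 2) (pt u v) = - (c *\<^sub>R e u)" "pd 2 (M 2 1) (pt u v) = - (c *\<^sub>R e u)"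
    using u by (simp_all add: M_pt)
  then show "unit_normal s e (pt u v) \<bullet> pd 2 (M 1 2) (pt u v) = 0"
    "unit_normal s e (pt u v) \<bullet> pd 2 (M 2 1) (pt u v) = 0"
    by (simp_all add: unit_normal_tangent u)
  have "((\<lambda>u. (1 / v) *\<^sub>R e u) has_vector_derivative (1 / v) *\<^sub>R N u) (at u)"
    by (auto intro!: derivative_eq_intros surface_derivatives u)
  from pd_1I[OF open_I u _ this, of "M 2 2"]
  have "pd 1 (M 2 2) (pt u v) = (1 / v) *\<^sub>R N u"
    using v by (simp add: M_pt)
  then show "unit_normal s e (pt u v) \<bullet> pd 1 (M 2 2) (pt u v) = d u / (v * w u v)"
    by (simp add: unit_normal_pt inner_simps frame u)
  have "((\<lambda>v. (1 / v) *\<^sub>R e u) has_vector_derivative (- 1 / v\<^sup>2) *\<^sub>R e u) (at v)"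
    using v by (auto intro!: derivative_eq_intros simp: power2_eq_square)
  from pd_2I[OF op _ this, of "M 2 2"]
  have "pd 2 (M 2 2) (pt u v) = (- 1 / v\<^sup>2) *\<^sub>R e u"
    using u by (simp add: M_pt)
  then show "unit_normal s e (pt u v) \<bullet> pd 2 (M 2 2) (pt u v) = 0"
    by (simp add: unit_normal_tangent u)
qed

lemma darboux_eq:
  assumes u: "u \<in> I"
  shows "darboux s e g i j m (pt u v) = w u v / (g u * v) *
    (unit_normal s e (pt u v) \<bullet> pd m (M i j) (pt u v)
      - (christoffel G 1 m i (pt u v) * second_ff s e (pt u v) $ 1 $ j
        + christoffel G 2 m i (pt u v) * second_ff s e (pt u v) $ 2 $ j)
      - (christoffel G 1 m j (pt u v) * second_ff s e (pt u v) $ i $ 1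
        + christoffel G 2 m j (pt u v) * second_ff s e (pt u v) $ i $ 2))"
  unfolding darboux_def cov2_def sum_2 inner_diff_right inner_add_right inner_scaleR_right
    unit_normal_M[OF u] support_fun_pt by simp

text \<open>Since \<open>G\<^sup>1\<^sup>1 = 0\<close>, components whose first two indices are both 1 do not enter \<open>T\<close>.\<close>

lemma darboux_pt:
  assumes u: "u \<in> I" and v: "v \<noteq> 0"
  shows
    "darboux s e g 1 2 1 (pt u v) = - k u / (2 * g u) - (D d u * g u - d u * D g u) / ((g u)\<^sup>2 * v)
       - (d u)\<^sup>2 * (k u - l u) / (2 * g u * v\<^sup>2)"
    "darboux s e g 2 1 1 (pt u v) = - k u / (2 * g u) - (D d u * g u - d u * D g u) / ((g u)\<^sup>2 * v)
       - (d u)\<^sup>2 * (k u - l u) / (2 * g u * v\<^sup>2)"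
    "darboux s e g 1 2 2 (pt u v) = d u / (g u * v\<^sup>2)"
    "darboux s e g 2 1 2 (pt u v) = d u / (g u * v\<^sup>2)"
    "darboux s e g 2 2 1 (pt u v) = d u / (g u * v\<^sup>2)"
    "darboux s e g 2 2 2 (pt u v) = 0"
  using v g_nz[OF u] d_nz[OF u] w_pos[OF u, of v]
  unfolding darboux_eq[OF u] unit_normal_pd_M[OF u v] christoffel_pt[OF u v] second_ff_pt[OF u]
  by (simp_all add: Gamma_def field_simps power2_eq_square)

section \<open>Closed form of the Tchebychev vector and its extension to the striction curve\<close>

definition tau :: "real \<Rightarrow> real \<Rightarrow> real" where
  "tau u v = beta u v + v * (d u * D g u / g u - D d u / 2)"

text \<open>As \<open>G^11 = 0\<close> and \<open>A_222 = 0\<close>, the first coefficient reduces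
  to \<open>(G^12)^2 A_122\<close>, where the powers of \<open>v\<close> cancel. They also cancel in
  the second, so both right-hand sides make sense at \<open>v = 0\<close>.\<close>

lemma tchebychev_coeff_pt:
  assumes u: "u \<in> I" and v: "v \<noteq> 0"
  shows "tchebychev_coeff s e g 1 (pt u v) = g u / d u"
    "tchebychev_coeff s e g 2 (pt u v) = g u * tau u v / (d u)\<^sup>2"
  using v g_nz[OF u] d_nz[OF u]
  by (simp_all add: tchebychev_coeff_def sum_2 rel_metric_inv_def rel_metric_inv_pt u darboux_pt)
    (simp_all add: tau_def beta_def field_simps power2_eq_square)

definition T :: "real \<Rightarrow> real \<Rightarrow> real^3" where
  "T u v = (g u / d u) *\<^sub>R X1 u v + (g u * tau u v / (d u)\<^sup>2) *\<^sub>R e u"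

lemma tchebychev_off_pt: "u \<in> I \<Longrightarrow> v \<noteq> 0 \<Longrightarrow> tchebychev_off s e g (pt u v) = T u v"
  by (simp add: tchebychev_off_def sum_2 tchebychev_coeff_pt pd_1_surf pd_2_surf T_def)

lemma continuous_T:
  assumes u: "u \<in> I"
  shows "continuous (at (pt u v) within A) (\<lambda>p. T (p $ 1) (p $ 2))"
proof -
  have v: "continuous (at (pt u v) within A) (\<lambda>p. p $ 2)"
    by (intro continuous_intros)
  have lift: "continuous (at (pt u v) within A) (\<lambda>p. h (p $ 1))" if "isCont h u"
    for h :: "real \<Rightarrow> 'a::t2_space"
    by (rule continuous_within_compose3[where g = h])
      (use that in \<open>simp_all add: continuous_component continuous_ident\<close>)
  note c = differentiable_imp_continuous_within[THEN lift, OF diffs(5)[OF u]]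
    differentiable_imp_continuous_within[THEN lift, OF diffs(6)[OF u]]
    differentiable_imp_continuous_within[THEN lift, OF diffs(7)[OF u]]
    differentiable_imp_continuous_within[THEN lift, OF diffs(8)[OF u]]
    differentiable_imp_continuous_within[THEN lift, OF diffs(9)[OF u]]
    differentiable_imp_continuous_within[THEN lift, OF diffs(10)[OF u]]
    has_vector_derivative_continuous[THEN lift, OF E_has_derivative[OF u]]
    has_vector_derivative_continuous[THEN lift, OF N_has_derivative[OF u]]
    has_vector_derivative_continuous[THEN lift, OF Z_has_derivative[OF u]]
  show ?thesis
    unfolding T_def X1_def tau_def beta_def
    by (intro continuous_add continuous_diff continuous_mult continuous_scaleR continuous_power
        continuous_at_within_divide continuous_const v c) (simp_all add: d_nz g_nz u)
qed

text \<open>Makes the filter in \<open>tchebychev\<close> nontrivial, so that \<open>Lim\<close>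
  there is determined by any limit found.\<close>

lemma islimpt_off_striction:
  assumes u: "u \<in> I"
  shows "pt u 0 islimpt off_striction I"
  unfolding islimpt_approachable
proof (intro allI impI)
  fix \<epsilon> :: real
  assume "0 < \<epsilon>"
  moreover have "pt u (\<epsilon> / 2) = pt u 0 + (\<epsilon> / 2) *\<^sub>R axis 2 1"
    by (simp add: pt_add_axis)
  then have "dist (pt u (\<epsilon> / 2)) (pt u 0) = \<bar>\<epsilon> / 2\<bar>"
    by (simp add: dist_norm)
  ultimately show "\<exists>p\<in>off_striction I. p \<noteq> pt u 0 \<and> dist p (pt u 0) < \<epsilon>"
    using u by (intro bexI[of _ "pt u (\<epsilon> / 2)"]) (auto simp: in_off)
qed

lemma tchebychev_pt:
  assumes u: "u \<in> I"
  shows "tchebychev s e g I (pt u v) = T u v"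
proof (cases "v = 0")
  case False
  with u show ?thesis by (simp add: tchebychev_def tchebychev_off_pt)
next
  case True
  have "at (pt u 0) within off_striction I \<noteq> bot"
    using islimpt_off_striction[OF u] by (simp add: trivial_limit_within)
  moreover have "(tchebychev_off s e g \<longlongrightarrow> T u 0) (at (pt u 0) within off_striction I)"
  proof (rule Lim_transform_within)
    show "((\<lambda>p. T (p $ 1) (p $ 2)) \<longlongrightarrow> T u 0) (at (pt u 0) within off_striction I)"
      using continuous_T[OF u, of 0 "off_striction I"] by (simp add: continuous_within)
    show "T (p $ 1) (p $ 2) = tchebychev_off s e g p" if "p \<in> off_striction I" for p
      using that tchebychev_off_pt[of "p $ 1" "p $ 2"] in_off[of "p $ 1" "p $ 2"]
      by (simp add: pt_eta)
  qed (rule zero_less_one)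
  ultimately show ?thesis
    using True by (simp add: tchebychev_def tendsto_Lim)
qed

section \<open>Principal directions\<close>

text \<open>The eigenvalue equation in coordinates, multiplied by \<open>w\<close>; the principal
  curvature then occurs only in the product \<open>c * w u v\<close>.\<close>

lemma principal_vector_iff:
  assumes u: "u \<in> I"
  shows "principal_vector s e (pt u v) c X \<longleftrightarrow> X \<noteq> 0 \<and>
    (\<exists>a b. X = a *\<^sub>R X1 u v + b *\<^sub>R e u \<and>
      d u * b - beta u v * a = c * w u v * (((w u v)\<^sup>2 + (d u)\<^sup>2 * (l u)\<^sup>2) * a + d u * l u * b) \<and>
      d u * a = c * w u v * (d u * l u * a + b))"
proof -
  have 1: "second_ff s e (pt u v) *v a = c *\<^sub>R (first_ff s e (pt u v) *v a) \<longleftrightarrow>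
      d u * a $ 2 - beta u v * a $ 1 =
        c * w u v * (((w u v)\<^sup>2 + (d u)\<^sup>2 * (l u)\<^sup>2) * a $ 1 + d u * l u * a $ 2) \<and>
      d u * a $ 1 = c * w u v * (d u * l u * a $ 1 + a $ 2)" for a
    using w_pos[OF u, of v]
    by (simp add: vec_eq_iff forall_2 matrix_vector_mult_def sum_2 second_ff_pt first_ff_pt u field_simps)
  show ?thesis
    unfolding principal_vector_def 1 sum_2 pd_1_surf[OF u] pd_2_surf
  proof (intro conj_cong refl iffI; elim exE)
    fix a b
    assume "X = a *\<^sub>R X1 u v + b *\<^sub>R e u \<and>
      d u * b - beta u v * a = c * w u v * (((w u v)\<^sup>2 + (d u)\<^sup>2 * (l u)\<^sup>2) * a + d u * l u * b) \<and>
      d u * a = c * w u v * (d u * l u * a + b)"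
    then show "\<exists>a::real^2. X = a $ 1 *\<^sub>R X1 u v + a $ 2 *\<^sub>R e u \<and>
      d u * a $ 2 - beta u v * a $ 1 =
        c * w u v * (((w u v)\<^sup>2 + (d u)\<^sup>2 * (l u)\<^sup>2) * a $ 1 + d u * l u * a $ 2) \<and>
      d u * a $ 1 = c * w u v * (d u * l u * a $ 1 + a $ 2)"
      by (intro exI[of _ "pt a b"]) simp
  qed blast
qed

lemma lin_X1_E_eq_0_iff: "u \<in> I \<Longrightarrow> a *\<^sub>R X1 u v + b *\<^sub>R e u = 0 \<longleftrightarrow> a = 0 \<and> b = 0"
  using X1_E_independent[of u a v b 0 0] by auto

section \<open>Necessary conditions\<close>

lemma T_principal_imp:
  assumes u: "u \<in> I" and T: "principal_vector s e (pt u v) c (T u v)"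
  defines "\<mu> \<equiv> d u * D g u / g u - D d u / 2"
  shows "v * \<mu> * (beta u v + v * \<mu>) = (d u)\<^sup>2 * (l u * beta u v + (d u)\<^sup>2 + v\<^sup>2 + (d u)\<^sup>2 * (l u)\<^sup>2)"
proof -
  obtain a b where ab: "T u v = a *\<^sub>R X1 u v + b *\<^sub>R e u"
    "d u * b - beta u v * a = c * w u v * (((w u v)\<^sup>2 + (d u)\<^sup>2 * (l u)\<^sup>2) * a + d u * l u * b)"
    "d u * a = c * w u v * (d u * l u * a + b)"
    using T unfolding principal_vector_iff[OF u] by blast
  define m where "m = g u / (d u)\<^sup>2"
  have "a = g u / d u" "b = g u * tau u v / (d u)\<^sup>2"
    using X1_E_independent[OF u ab(1)[unfolded T_def]] by simp_all
  then have a: "a = m * d u" and b: "b = m * (beta u v + v * \<mu>)"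
    by (simp_all add: m_def tau_def \<mu>_def power2_eq_square)
  have m: "m \<noteq> 0"
    using g_nz[OF u] d_nz[OF u] by (simp add: m_def)
  \<comment> \<open>Cross-multiplying the two eigenvalue equations eliminates
    \<open>c * w u v\<close> without a division.\<close>
  have "(d u * b - beta u v * a) * (d u * l u * a + b) =
      (((w u v)\<^sup>2 + (d u)\<^sup>2 * (l u)\<^sup>2) * a + d u * l u * b) * (d u * a)"
    unfolding ab(2,3) by (simp add: algebra_simps)
  then have "m\<^sup>2 * d u * (v * \<mu> * (beta u v + v * \<mu>)) =
      m\<^sup>2 * d u * ((d u)\<^sup>2 * (l u * beta u v + (w u v)\<^sup>2 + (d u)\<^sup>2 * (l u)\<^sup>2))"
    unfolding a b by algebra
  with m d_nz[OF u] show ?thesis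
    by (simp add: w_sq)
qed

text \<open>The conditions at a single \<open>u\<close>, with constancy and minimality replaced by
  vanishing derivatives: comparing coefficients in \<open>v\<close> works for each \<open>u\<close>
  separately.\<close>

definition minimal_edlinger_at :: "real \<Rightarrow> bool" where
  "minimal_edlinger_at u \<longleftrightarrow> k u * l u = -1 \<and> D d u = 0 \<and> D g u = 0"

lemma T_principal_imp_special:
  assumes u: "u \<in> I" and T: "\<And>v. \<exists>c. principal_vector s e (pt u v) c (T u v)"
  shows "minimal_edlinger_at u"
proof -
  define \<mu> where "\<mu> = d u * D g u / g u - D d u / 2"
  \<comment> \<open>Coefficients of the cubic in \<open>v\<close> obtained by expanding
    \<open>beta\<close> and moving everything to the left.\<close>
  define c0 where "c0 = - ((d u)^4 * (k u * l u + 1))"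
  define c1 where "c1 = (d u)\<^sup>2 * (\<mu> * (k u - l u) - D d u * l u)"
  define c2 where "c2 = \<mu> * (D d u + \<mu>) - (d u)\<^sup>2 * (k u * l u + 1)"
  define c3 where "c3 = \<mu> * k u"
  have *: "c0 + c1 * v + c2 * v\<^sup>2 + c3 * v^3 = 0" for v
  proof -
    obtain c where "principal_vector s e (pt u v) c (T u v)"
      using T by blast
    from T_principal_imp[OF u this, folded \<mu>_def] show ?thesis
      unfolding beta_def c0_def c1_def c2_def c3_def by algebra
  qed
  \<comment> \<open>Five values of \<open>v\<close> form a linear system that determines the four
    coefficients.\<close>
  have "c0 = 0" "c1 = 0" "c3 = 0"
    using *[of 0] *[of 1] *[of "-1"] *[of 2] *[of "-2"] by simp_all
  \<comment> \<open>\<open>c0\<close> gives \<open>k u * l u = -1\<close>, so neither factor is 0;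
    then \<open>c3\<close> gives \<open>\<mu> = 0\<close>, and with it \<open>c1\<close> gives
    \<open>D d u = 0\<close>.\<close>
  then have kl: "k u * l u = -1" and mu: "\<mu> = 0" and "D d u = 0"
    using d_nz[OF u] by (auto simp: c0_def c1_def c3_def)
  moreover from mu \<open>D d u = 0\<close> have "D g u = 0"
    using d_nz[OF u] g_nz[OF u] by (simp add: \<mu>_def)
  ultimately show ?thesis
    by (simp add: minimal_edlinger_at_def)
qed

text \<open>A vanishing derivative of \<open>d\<close> means constancy because \<open>I\<close> is
  an interval, and \<open>H = D g u / d u\<close> turns minimality into
  \<open>D g u = 0\<close>.\<close>

lemma edlinger_minimal_iff:
  "edlinger_surface s e I \<and> relatively_minimal s e g I \<longleftrightarrow> (\<forall>u\<in>I. minimal_edlinger_at u)"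
proof -
  have "d constant_on I \<longleftrightarrow> (\<forall>u\<in>I. D d u = 0)"
  proof
    assume "d constant_on I"
    then obtain c where c: "\<And>u. u \<in> I \<Longrightarrow> d u = c"
      by (auto simp: constant_on_def)
    show "\<forall>u\<in>I. D d u = 0"
    proof
      fix u assume u: "u \<in> I"
      show "D d u = 0"
        by (rule vector_derivative_at)
          (rule has_vector_derivative_transform_within_open[OF has_vector_derivative_const open_I u], simp add: c)
    qed
  next
    assume 0: "\<forall>u\<in>I. D d u = 0"
    have "(d has_vector_derivative 0) (at u within I)" if "u \<in> I" for u
      using D_has_vector_derivative[OF diffs(5)[OF that]] 0 that
      by (simp add: has_vector_derivative_at_within)
    from has_vector_derivative_zero_constant[OF _ this] interval_I obtain c where "\<And>u. u \<in> I \<Longrightarrow> d u = c"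
      by (metis is_interval_convex)
    then show "d constant_on I"
      by (auto simp: constant_on_def)
  qed
  moreover have "relatively_minimal s e g I \<longleftrightarrow> (\<forall>u\<in>I. D g u = 0)"
  proof
    assume m: "relatively_minimal s e g I"
    show "\<forall>u\<in>I. D g u = 0"
    proof
      fix u assume u: "u \<in> I"
      \<comment> \<open>Any nonzero \<open>v\<close> would serve, as \<open>H\<close> depends on
        \<open>u\<close> alone.\<close>
      with m have "rel_mean_curvature s e g (pt u 1) = 0"
        unfolding relatively_minimal_def by (simp add: in_off)
      then show "D g u = 0"
        using d_nz[OF u] by (simp add: rel_mean_curvature_pt u)
    qed
  next
    assume "\<forall>u\<in>I. D g u = 0"
    then have "rel_mean_curvature s e g p = 0" if "p \<in> off_striction I" for p
      using that rel_mean_curvature_pt[of "p $ 1" "p $ 2"] in_off[of "p $ 1" "p $ 2"] by (simp add: pt_eta)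
    then show "relatively_minimal s e g I"
      by (simp add: relatively_minimal_def)
  qed
  moreover have "k u * l u + 1 = 0 \<longleftrightarrow> k u * l u = -1" for u
    by linarith
  ultimately show ?thesis
    by (auto simp: edlinger_surface_def minimal_edlinger_at_def)
qed

section \<open>Principal directions under the pointwise conditions\<close>

context
  fixes u
  assumes u: "u \<in> I" and sp: "minimal_edlinger_at u"
begin

lemma k_nz: "k u \<noteq> 0"
  using sp by (auto simp: minimal_edlinger_at_def)

lemma T_special: "T u v = (g u / d u) *\<^sub>R (X1 u v + (beta u v / d u) *\<^sub>R e u)"
  using sp by (simp add: T_def tau_def minimal_edlinger_at_def scaleR_add_right power2_eq_square)

lemma beta_special: "beta u v = k u * (w u v)\<^sup>2 - (d u)\<^sup>2 * l u"
  using sp unfolding beta_def minimal_edlinger_at_def w_sq by algebra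

text \<open>Multiplied by \<open>k u\<close>, it becomes a sum of squares with a nonzero summand,
  since \<open>k u * l u = -1\<close>.\<close>

lemma beta_nz: "beta u v \<noteq> 0"
proof -
  have "k u * beta u v = (k u)\<^sup>2 * (w u v)\<^sup>2 + (d u)\<^sup>2"
    using sp unfolding beta_special minimal_edlinger_at_def by algebra
  moreover have "\<dots> > 0"
    using d_nz[OF u] by (intro add_nonneg_pos) auto
  ultimately show ?thesis by auto
qed

lemma principal_vector_special:
  "principal_vector s e (pt u v) c X \<longleftrightarrow>
    c = (d u)\<^sup>2 / (k u * w u v ^ 3) \<and> (\<exists>t. t \<noteq> 0 \<and> X = t *\<^sub>R T u v) \<or>
    c = - k u / w u v \<and> (\<exists>t. t \<noteq> 0 \<and> X = t *\<^sub>R X1 u v)"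
  (is "_ \<longleftrightarrow> c = ?c1 \<and> ?T \<or> c = ?c2 \<and> ?X")
proof -
  have kl: "k u * l u = -1"
    using sp by (simp add: minimal_edlinger_at_def)
  note nz = d_nz[OF u] g_nz[OF u] k_nz w_pos[OF u, of v]
  show ?thesis
  proof
    assume "principal_vector s e (pt u v) c X"
    then obtain a b where ab: "X \<noteq> 0" "X = a *\<^sub>R X1 u v + b *\<^sub>R e u"
      "d u * b - beta u v * a = c * w u v * (((w u v)\<^sup>2 + (d u)\<^sup>2 * (l u)\<^sup>2) * a + d u * l u * b)"
      "d u * a = c * w u v * (d u * l u * a + b)"
      unfolding principal_vector_iff[OF u] by blast
    have "(d u * b - beta u v * a) * (d u * l u * a + b) =
        (((w u v)\<^sup>2 + (d u)\<^sup>2 * (l u)\<^sup>2) * a + d u * l u * b) * (d u * a)"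
      unfolding ab(3,4) by (simp add: algebra_simps)
    \<comment> \<open>The equation factors because \<open>l * beta + w^2 + d^2 * l^2 = 0\<close>
      under the conditions. The factors stand for the directions \<open>X1\<close> and
      \<open>T\<close>.\<close>
    then have "b * (d u * b - beta u v * a) = 0"
      using kl unfolding beta_special by algebra
    then consider "b = 0" | "d u * b = beta u v * a" by auto
    then show "c = ?c1 \<and> ?T \<or> c = ?c2 \<and> ?X"
    proof cases
      case 1
      with ab(1,2) have a: "a \<noteq> 0" by auto
      have "c * w u v * l u = 1"
        using ab(4) a nz 1 by simp
      with kl have "c * w u v = - k u" by algebra
      then have "c = ?c2"
        using nz by (simp add: field_simps)
      with a 1 ab(2) show ?thesis by auto
    next
      case 2
      then have b: "b = beta u v * a / d u"
        using nz by (simp add: field_simps)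
      with ab(1,2) have a: "a \<noteq> 0" by auto
      \<comment> \<open>The extra factor \<open>d u\<close> allows \<open>d u * b\<close> to be
        replaced by \<open>beta u v * a\<close>; then \<open>beta_special\<close> collapses the
        bracket.\<close>
      have "(d u)\<^sup>2 * a = c * w u v * ((d u)\<^sup>2 * l u * a + d u * b)"
        using ab(4) by algebra
      also have "\<dots> = c * w u v * k u * (w u v)\<^sup>2 * a"
        unfolding 2 beta_special by algebra
      finally have "(d u)\<^sup>2 = c * (k u * w u v ^ 3)"
        using a by (simp add: power2_eq_square power3_eq_cube)
      then have "c = ?c1"
        using nz by (simp add: field_simps)
      moreover have "X = (a * d u / g u) *\<^sub>R T u v"
        using nz by (simp add: ab(2) b T_special scaleR_add_right)
      moreover have "a * d u / g u \<noteq> 0"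
        using a nz by simp
      ultimately show ?thesis by blast
    qed
  next
    assume "c = ?c1 \<and> ?T \<or> c = ?c2 \<and> ?X"
    then show "principal_vector s e (pt u v) c X"
    proof (elim disjE conjE exE)
      fix t assume c: "c = ?c1" and t: "t \<noteq> 0" "X = t *\<^sub>R T u v"
      define a b where "a = t * g u / d u" and "b = beta u v * a / d u"
      have X: "X = a *\<^sub>R X1 u v + b *\<^sub>R e u"
        using nz by (simp add: t(2) T_special scaleR_add_right a_def b_def mult_ac)
      have a: "a \<noteq> 0"
        using nz t(1) by (simp add: a_def)
      have db: "d u * b = beta u v * a"
        using nz by (simp add: b_def)
      have "c * w u v * (k u * (w u v)\<^sup>2) = (d u)\<^sup>2"
        using nz by (simp add: c power2_eq_square power3_eq_cube)
      moreover have "d u * (d u * l u * a + b) = k u * (w u v)\<^sup>2 * a"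
        unfolding distrib_left db beta_special by algebra
      ultimately have "d u * (d u * a) = d u * (c * w u v * (d u * l u * a + b))"
        by algebra
      \<comment> \<open>Both sides of the first eigenvalue equation vanish along \<open>T\<close>,
        so only the second one fixes the curvature.\<close>
      moreover have "((w u v)\<^sup>2 + (d u)\<^sup>2 * (l u)\<^sup>2) * a + d u * l u * b = 0"
        using kl db unfolding beta_special by algebra
      ultimately show ?thesis
        using nz X a unfolding principal_vector_iff[OF u]
        by (intro conjI exI[of _ a] exI[of _ b]) (simp_all add: lin_X1_E_eq_0_iff u db)
    next
      fix t assume c: "c = ?c2" and t: "t \<noteq> 0" "X = t *\<^sub>R X1 u v"
      have cw: "c * w u v = - k u"
        using nz by (simp add: c)
      have "- beta u v = - k u * ((w u v)\<^sup>2 + (d u)\<^sup>2 * (l u)\<^sup>2)"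
        using kl unfolding beta_special by algebra
      moreover have "d u = - k u * (d u * l u)"
        using kl by algebra
      ultimately have "d u * 0 - beta u v * t = c * w u v * (((w u v)\<^sup>2 + (d u)\<^sup>2 * (l u)\<^sup>2) * t + d u * l u * 0)"
        "d u * t = c * w u v * (d u * l u * t + 0)"
        unfolding cw by algebra+
      moreover have "X \<noteq> 0"
        using lin_X1_E_eq_0_iff[OF u, of t v 0] t by simp
      ultimately show ?thesis
        using t(2) unfolding principal_vector_iff[OF u]
        by (intro conjI exI[of _ t] exI[of _ 0]) simp_all
    qed
  qed
qed

text \<open>The curvature along \<open>T\<close> has the sign of \<open>k u\<close>, the one along
  \<open>X1\<close> the opposite sign. Hence \<open>T\<close> belongs to the larger curvature if
  \<open>k u\<close> is positive and to the smaller one if it is negative.\<close>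

lemma family_direction_special:
  "family_direction s e F (pt u v) X \<longleftrightarrow>
    (\<exists>t. t \<noteq> 0 \<and> X = t *\<^sub>R (if (F = Larger) = (k u > 0) then T u v else X1 u v))"
proof -
  define c1 where "c1 = (d u)\<^sup>2 / (k u * w u v ^ 3)"
  define c2 where "c2 = - k u / w u v"
  have "principal_curvatures s e (pt u v) = {c1, c2}"
    unfolding principal_curvatures_def principal_vector_special c1_def[symmetric] c2_def[symmetric]
    by (auto intro: exI[of _ 1])
  then have "family_curvature s e F (pt u v) = (if F = Larger then max c1 c2 else min c1 c2)"
    by (cases F) simp_all
  moreover have "k u > 0 \<Longrightarrow> c1 > 0 \<and> c2 < 0" "k u < 0 \<Longrightarrow> c1 < 0 \<and> c2 > 0"
    using w_pos[OF u, of v] d_nz[OF u]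
    by (simp_all add: c1_def c2_def divide_less_0_iff zero_less_divide_iff mult_less_0_iff zero_less_mult_iff)
  ultimately have "family_curvature s e F (pt u v) = (if (F = Larger) = (k u > 0) then c1 else c2)" "c1 \<noteq> c2"
    using k_nz by (cases "k u > 0"; force)+
  then show ?thesis
    unfolding family_direction_def principal_vector_special c1_def[symmetric] c2_def[symmetric]
    by auto
qed

lemma T_not_parallel_X1: "T u v \<noteq> t *\<^sub>R X1 u v"
  using X1_E_independent(2)[OF u, of "g u / d u" v "g u / d u * (beta u v / d u)" t 0]
    d_nz[OF u] g_nz[OF u] beta_nz[of v] by (auto simp: T_special scaleR_add_right)

text \<open>At \<open>v = 0\<close> the product is a multiple of
  \<open>1 + k u * l u\<close>.\<close>

lemma T_orthogonal_striction: "T u 0 \<bullet> D s u = 0"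
proof -
  have "T u 0 \<bullet> D s u = g u / d u * ((d u * l u)\<^sup>2 + (d u)\<^sup>2 + beta u 0 * l u)"
    using d_nz[OF u] by (simp add: T_special Ds u X1_def inner_simps frame field_simps power2_eq_square)
  also have "(d u * l u)\<^sup>2 + (d u)\<^sup>2 + beta u 0 * l u = 0"
  proof -
    have "k u * l u = -1" "beta u 0 = (d u)\<^sup>2 * (k u - l u)"
      using sp by (simp_all add: minimal_edlinger_at_def beta_def)
    then show ?thesis by algebra
  qed
  finally show ?thesis
    by simp
qed

lemma X1_striction: "X1 u 0 \<bullet> D s u \<noteq> 0"
proof -
  have "X1 u 0 = D s u"
    by (simp add: X1_def Ds u)
  moreover have "D s u \<noteq> 0"
    using lin_X1_E_eq_0_iff[OF u, of 1 0 0] calculation by auto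
  ultimately show ?thesis by simp
qed

end

section \<open>One family for the whole surface\<close>

lemma k_sign_constant:
  assumes sp: "\<forall>u\<in>I. minimal_edlinger_at u" and "u \<in> I" "u' \<in> I"
  shows "k u > 0 \<longleftrightarrow> k u' > 0"
proof -
  have "continuous_on I k"
    using diffs(7) by (intro continuous_at_imp_continuous_on ballI differentiable_imp_continuous_within)
  \<comment> \<open>A connected image avoiding 0 lies on one side of it; this keeps \<open>T\<close>
    in the same family for all \<open>u\<close>.\<close>
  then have "connected (k ` I)"
    using interval_I by (intro connected_continuous_image is_interval_connected)
  moreover have "0 \<notin> k ` I"
    using k_nz sp by fastforce
  ultimately show ?thesis
    using assms(2,3) connectedD_interval[of "k ` I" "k u" "k u'" 0]
      connectedD_interval[of "k ` I" "k u'" "k u" 0] by (metis imageI linorder_not_less order_less_imp_le)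
qed

lemma param_domE:
  assumes "p \<in> param_dom I"
  obtains u v where "p = pt u v" "u \<in> I"
  using assms pt_eta[of p] by (metis in_dom)

lemma tangential_iff:
  "tangential_to_family s e I F (tchebychev s e g I) \<longleftrightarrow> (\<forall>u\<in>I. \<forall>v. family_direction s e F (pt u v) (T u v))"
  unfolding tangential_to_family_def by (metis param_domE in_dom tchebychev_pt)

lemma tangential_special:
  assumes F: "tangential_to_family s e I F (tchebychev s e g I)" and u: "u \<in> I"
  shows "minimal_edlinger_at u" "(F = Larger) = (k u > 0)"
proof -
  show sp: "minimal_edlinger_at u"
    using F u unfolding tangential_iff family_direction_def by (intro T_principal_imp_special) auto
  from F u have "family_direction s e F (pt u 0) (T u 0)"
    unfolding tangential_iff by blast
  \<comment> \<open>The other family would make \<open>T\<close> a multiple of \<open>X1\<close>,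
    which is impossible.\<close>
  then show "(F = Larger) = (k u > 0)"
    unfolding family_direction_special[OF u sp]
    using T_not_parallel_X1[OF u sp, of 0] by (metis (full_types))
qed

lemma special_tangential:
  assumes sp: "\<forall>u\<in>I. minimal_edlinger_at u"
  shows "\<exists>F. tangential_to_family s e I F (tchebychev s e g I)"
proof -
  obtain u0 where u0: "u0 \<in> I"
    using I_ne by blast
  \<comment> \<open>By constancy of the sign of \<open>k\<close>, a single base point decides the
    family.\<close>
  define F where "F = (if k u0 > 0 then Larger else Smaller)"
  have "family_direction s e F (pt u v) (T u v)" if u: "u \<in> I" for u v
    using sp u k_sign_constant[OF sp u u0]
    by (subst family_direction_special) (auto simp: F_def intro: exI[of _ 1])
  then show ?thesis
    unfolding tangential_iff by blast
qed

text \<open>On the striction curve \<open>X1\<close> is \<open>D s u\<close> itself and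
  \<open>T\<close> is orthogonal to it, so orthogonality to \<open>D s u\<close> tells the two
  families apart.\<close>

lemma tangential_striction:
  assumes F: "tangential_to_family s e I F (tchebychev s e g I)" and u: "u \<in> I"
    and X: "family_direction s e F' (pt u 0) X"
  shows "F' = F \<longleftrightarrow> X \<bullet> D s u = 0"
proof -
  note sp = tangential_special[OF F u]
  have "F' = F \<longleftrightarrow> (F' = Larger) = (k u > 0)"
    using sp(2) by (cases F; cases F') auto
  then show ?thesis
    using X T_orthogonal_striction[OF u sp(1)] X1_striction[OF u sp(1)]
    by (auto simp: family_direction_special[OF u sp(1)] split: if_splits)
qed

end

theorem proposition5p1:
  fixes s e :: "real \<Rightarrow> real^3" and g :: "real \<Rightarrow> real" and I :: "real set" and r :: nat
  assumes "r \<ge> 3"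
    and "skew_ruled_surface r s e I"
    and "sufficiently_smooth s e g I"
    and "\<forall>u\<in>I. g u \<noteq> 0"
  shows "((\<exists>F. tangential_to_family s e I F (tchebychev s e g I)) \<longleftrightarrow>
            edlinger_surface s e I \<and> relatively_minimal s e g I) \<and>
         (\<forall>F. tangential_to_family s e I F (tchebychev s e g I) \<longrightarrow>
            (\<forall>F' u X. u \<in> I \<and> family_direction s e F' (vector [u, 0]) X \<longrightarrow>
               (F' = F \<longleftrightarrow> X \<bullet> D s u = 0)) \<and>
            (\<forall>F' J c t. line_of_curvature s e I F' J c \<and> t \<in> J \<and> c t $ 2 = 0 \<longrightarrow>
               (F' = F \<longleftrightarrow> D (\<lambda>\<tau>. surf s e (c \<tau>)) t \<bullet> D s (c t $ 1) = 0)))"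
proof -
  interpret central_surface s e g I r
    using assms by unfold_locales auto
  show ?thesis
  proof (intro conjI allI impI)
    show "(\<exists>F. tangential_to_family s e I F (tchebychev s e g I)) \<longleftrightarrow>
        edlinger_surface s e I \<and> relatively_minimal s e g I"
      unfolding edlinger_minimal_iff using tangential_special(1) special_tangential by blast
  next
    fix F F' u X
    assume "tangential_to_family s e I F (tchebychev s e g I)"
      and "u \<in> I \<and> family_direction s e F' (vector [u, 0]) X"
    then show "F' = F \<longleftrightarrow> X \<bullet> D s u = 0"
      using tangential_striction by blast
  next
    fix F F' J c t
    assume F: "tangential_to_family s e I F (tchebychev s e g I)"
      and c: "line_of_curvature s e I F' J c \<and> t \<in> J \<and> c t $ 2 = 0"
    then have "pt (c t $ 1) 0 = c t" "c t $ 1 \<in> I"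
      "family_direction s e F' (c t) (D (\<lambda>\<tau>. surf s e (c \<tau>)) t)"
      using pt_eta[of "c t"] by (auto simp: line_of_curvature_def param_dom_def)
    then show "F' = F \<longleftrightarrow> D (\<lambda>\<tau>. surf s e (c \<tau>)) t \<bullet> D s (c t $ 1) = 0"
      using tangential_striction[OF F] by metis
  qed
qed

end
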